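(* Let $\Gamma=\langle \alpha_1,\ldots,\alpha_k\rangle\subset\mathbb N^d$ be an affine semigroup with minimal generators $\alpha_1,\ldots,\alpha_k$, let $\mathbb K$ be a field, and let $\Gamma_H=\langle (1,0),(1,\alpha_1),\ldots,(1,\alpha_k)\rangle\subset\mathbb N^{d+1}$. Let $\mathrm I_{\Gamma_H}\subset\mathbb K[t,y_1,\ldots,y_k]$ be the kernel of the ring homomorphism $\mathbb K[t,y_1,\ldots,y_k]\to\mathbb K[s_0,s_1,\ldots,s_d]$ given by $t\mapsto s_0$ and $y_i\mapsto s_0 s^{\alpha_i}$. Let $G$ be a reduced Gröbner basis of $\mathrm I_{\Gamma_H}$ with respect to a lexicographic monomial order with $t>y_i$ for every $i\le k$. For $j\ge 0$ let $$I_j=\big\langle y^z-y^w : \gamma\in\Gamma,\ z,w\in\mathsf Z(\gamma),\ \big||w|-|z|\big|\le j\big\rangle\subset\mathbb K[y_1,\ldots,y_k]$$ and $$J_j=\big\langle y^z-y^w : i\in\mathbb N,\ z,w\in\mathbb N^k,\ t^iy^z-y^w\in G,\ i\le j\big\rangle.$$ Then $I_j=J_j$ for every $j\ge 0$.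
   Context: An affine semigroup is a finitely generated submonoid of $\mathbb N^d$, with unique minimal generating set $\alpha_1,\ldots,\alpha_k$. A factorization of $\gamma\in\Gamma$ is $z\in\mathbb N^k$ with $z_1\alpha_1+\cdots+z_k\alpha_k=\gamma$; $\mathsf Z(\gamma)$ denotes the set of factorizations, and $|z|=z_1+\cdots+z_k$. For $z\in\mathbb N^k$, $y^z=y_1^{z_1}\cdots y_k^{z_k}$, and for $\alpha\in\mathbb N^d$, $s^{\alpha}=s_1^{\alpha_1}\cdots s_d^{\alpha_d}$. *)

theory Defs
  imports "HOL-Library.Poly_Mapping" "HOL-Algebra.RingHom"
begin

text \<open>
  Variables are indexed by natural numbers. Exponent vectors are finitely supported maps
  \<open>nat \<Rightarrow>\<^sub>0 nat\<close> and polynomials are finitely supported maps from exponent vectors to coefficients.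
  The lattice \<open>\<nat>\<^sup>X\<close> and the polynomial ring \<open>K[X]\<close> are carved out by the variable set \<open>X\<close>:
  \<open>\<nat>\<^sup>d\<close> is \<open>expvecs {1..d}\<close>, \<open>K[y\<^sub>1,\<dots>,y\<^sub>k]\<close> is \<open>mpoly_ring {1..k}\<close>, and the index \<open>0\<close> is reserved for
  \<open>t\<close> and \<open>s\<^sub>0\<close>, so that \<open>K[t,y\<^sub>1,\<dots>,y\<^sub>k]\<close> is \<open>mpoly_ring {0..k}\<close>. In this way
  \<open>K[y\<^sub>1,\<dots>,y\<^sub>k]\<close> is literally a subring of \<open>K[t,y\<^sub>1,\<dots>,y\<^sub>k]\<close>.
\<close>

type_synonym expvec = "nat \<Rightarrow>\<^sub>0 nat"
type_synonym 'a mpol = "expvec \<Rightarrow>\<^sub>0 'a"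

definition expvecs :: "nat set \<Rightarrow> expvec set" where
  "expvecs X = {m. Poly_Mapping.keys m \<subseteq> X}"

definition total_degree :: "expvec \<Rightarrow> nat" where
  "total_degree z = (\<Sum>v\<in>Poly_Mapping.keys z. Poly_Mapping.lookup z v)"

definition mpoly_ring :: "nat set \<Rightarrow> 'a::comm_ring_1 mpol ring" where
  "mpoly_ring X =
     \<lparr>carrier = {p. Poly_Mapping.keys p \<subseteq> expvecs X},
      monoid.mult = (*), one = 1, zero = 0, add = (+)\<rparr>"

definition monom :: "expvec \<Rightarrow> 'a::comm_ring_1 mpol" where
  "monom m = Poly_Mapping.single m 1"

definition var :: "nat \<Rightarrow> 'a::comm_ring_1 mpol" where
  "var v = monom (Poly_Mapping.single v 1)"

definition const :: "'a \<Rightarrow> 'a::comm_ring_1 mpol" where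
  "const c = Poly_Mapping.single 0 c"

definition poly_subst :: "(nat \<Rightarrow> 'a mpol) \<Rightarrow> 'a mpol \<Rightarrow> 'a::comm_ring_1 mpol" where
  "poly_subst \<sigma> p =
     (\<Sum>m\<in>Poly_Mapping.keys p. const (Poly_Mapping.lookup p m) *
        (\<Prod>v\<in>Poly_Mapping.keys m. \<sigma> v ^ Poly_Mapping.lookup m v))"


subsection \<open>Affine semigroups and factorizations\<close>

inductive_set submonoid_span :: "expvec set \<Rightarrow> expvec set" for S where
  zero: "0 \<in> submonoid_span S"
| gen: "a \<in> S \<Longrightarrow> a \<in> submonoid_span S"
| add: "a \<in> submonoid_span S \<Longrightarrow> b \<in> submonoid_span S \<Longrightarrow> a + b \<in> submonoid_span S"

definition affine_semigroup :: "nat \<Rightarrow> expvec set \<Rightarrow> bool" where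
  "affine_semigroup d \<Gamma> \<longleftrightarrow>
     \<Gamma> \<subseteq> expvecs {1..d} \<and> (\<exists>S. finite S \<and> \<Gamma> = submonoid_span S)"

definition minimal_generators :: "nat \<Rightarrow> (nat \<Rightarrow> expvec) \<Rightarrow> expvec set \<Rightarrow> bool" where
  "minimal_generators k \<alpha> \<Gamma> \<longleftrightarrow>
     inj_on \<alpha> {1..k} \<and> submonoid_span (\<alpha> ` {1..k}) = \<Gamma> \<and>
     (\<forall>T. T \<subset> \<alpha> ` {1..k} \<longrightarrow> submonoid_span T \<noteq> \<Gamma>)"

text \<open>The equation \<open>z\<^sub>1 \<alpha>\<^sub>1 + \<dots> + z\<^sub>k \<alpha>\<^sub>k = \<gamma>\<close> is written out coordinatewise.\<close>

definition factorizations :: "nat \<Rightarrow> (nat \<Rightarrow> expvec) \<Rightarrow> expvec \<Rightarrow> expvec set" where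
  "factorizations k \<alpha> \<gamma> =
     {z \<in> expvecs {1..k}. \<forall>c.
        (\<Sum>i=1..k. Poly_Mapping.lookup z i * Poly_Mapping.lookup (\<alpha> i) c) =
        Poly_Mapping.lookup \<gamma> c}"


subsection \<open>Reduced Groebner bases\<close>

text \<open>A pair \<open>(u, v)\<close> in the variable order \<open>r\<close> means that \<open>v\<close> is at least as large as \<open>u\<close>.\<close>

definition lex_less :: "nat set \<Rightarrow> nat rel \<Rightarrow> expvec \<Rightarrow> expvec \<Rightarrow> bool" where
  "lex_less X r m n \<longleftrightarrow>
     (\<exists>v\<in>X. Poly_Mapping.lookup m v < Poly_Mapping.lookup n v \<and>
        (\<forall>u\<in>X. (v, u) \<in> r \<and> u \<noteq> v \<longrightarrow> Poly_Mapping.lookup m u = Poly_Mapping.lookup n u))"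

definition lead_monom :: "(expvec \<Rightarrow> expvec \<Rightarrow> bool) \<Rightarrow> 'a::comm_ring_1 mpol \<Rightarrow> expvec" where
  "lead_monom lt p =
     (THE m. m \<in> Poly_Mapping.keys p \<and> (\<forall>n\<in>Poly_Mapping.keys p. n \<noteq> m \<longrightarrow> lt n m))"

definition lead_coeff :: "(expvec \<Rightarrow> expvec \<Rightarrow> bool) \<Rightarrow> 'a::comm_ring_1 mpol \<Rightarrow> 'a" where
  "lead_coeff lt p = Poly_Mapping.lookup p (lead_monom lt p)"

definition lead_term :: "(expvec \<Rightarrow> expvec \<Rightarrow> bool) \<Rightarrow> 'a::comm_ring_1 mpol \<Rightarrow> 'a mpol" where
  "lead_term lt p = Poly_Mapping.single (lead_monom lt p) (lead_coeff lt p)"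

definition lead_ideal ::
  "nat set \<Rightarrow> (expvec \<Rightarrow> expvec \<Rightarrow> bool) \<Rightarrow> 'a::comm_ring_1 mpol set \<Rightarrow> 'a mpol set" where
  "lead_ideal X lt F = Idl\<^bsub>mpoly_ring X\<^esub> (lead_term lt ` (F - {0}))"

definition groebner_basis ::
  "nat set \<Rightarrow> (expvec \<Rightarrow> expvec \<Rightarrow> bool) \<Rightarrow> 'a::field mpol set \<Rightarrow> 'a mpol set \<Rightarrow> bool" where
  "groebner_basis X lt I G \<longleftrightarrow>
     finite G \<and> G \<subseteq> I \<and> lead_ideal X lt G = lead_ideal X lt I"

definition reduced_groebner_basis ::
  "nat set \<Rightarrow> (expvec \<Rightarrow> expvec \<Rightarrow> bool) \<Rightarrow> 'a::field mpol set \<Rightarrow> 'a mpol set \<Rightarrow> bool" where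
  "reduced_groebner_basis X lt I G \<longleftrightarrow>
     groebner_basis X lt I G \<and> 0 \<notin> G \<and>
     (\<forall>g\<in>G. lead_coeff lt g = 1 \<and>
        (\<forall>m\<in>Poly_Mapping.keys g. monom m \<notin> lead_ideal X lt (G - {g})))"


subsection \<open>The ideals\<close>

definition homog_image :: "(nat \<Rightarrow> expvec) \<Rightarrow> nat \<Rightarrow> 'a::comm_ring_1 mpol" where
  "homog_image \<alpha> v = (if v = 0 then var 0 else var 0 * monom (\<alpha> v))"

definition homog_toric_ideal ::
  "nat \<Rightarrow> nat \<Rightarrow> (nat \<Rightarrow> expvec) \<Rightarrow> 'a::field mpol set" where
  "homog_toric_ideal d k \<alpha> =
     a_kernel (mpoly_ring {0..k}) (mpoly_ring {0..d}) (poly_subst (homog_image \<alpha>))"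

definition length_diff_ideal ::
  "nat \<Rightarrow> (nat \<Rightarrow> expvec) \<Rightarrow> expvec set \<Rightarrow> nat \<Rightarrow> 'a::field mpol set" where
  "length_diff_ideal k \<alpha> \<Gamma> j =
     Idl\<^bsub>mpoly_ring {1..k}\<^esub> {monom z - monom w | \<gamma> z w.
        \<gamma> \<in> \<Gamma> \<and> z \<in> factorizations k \<alpha> \<gamma> \<and> w \<in> factorizations k \<alpha> \<gamma> \<and>
        \<bar>int (total_degree w) - int (total_degree z)\<bar> \<le> int j}"

definition basis_ideal :: "nat \<Rightarrow> 'a::field mpol set \<Rightarrow> nat \<Rightarrow> 'a mpol set" where
  "basis_ideal k G j =
     Idl\<^bsub>mpoly_ring {1..k}\<^esub> {monom z - monom w | i z w.
        z \<in> expvecs {1..k} \<and> w \<in> expvecs {1..k} \<and>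
        var 0 ^ i * monom z - monom w \<in> G \<and> i \<le> j}"


subsection \<open>Basic facts\<close>

lemma expvecs_0: "0 \<in> expvecs X"
  by (simp add: expvecs_def)

lemma expvecs_add: "m \<in> expvecs X \<Longrightarrow> n \<in> expvecs X \<Longrightarrow> m + n \<in> expvecs X"
  using Poly_Mapping.keys_add[of m n] by (auto simp: expvecs_def)

lemma mpoly_ring_simps [simp]:
  "carrier (mpoly_ring X) = {p. Poly_Mapping.keys p \<subseteq> expvecs X}"
  "x \<otimes>\<^bsub>mpoly_ring X\<^esub> y = x * y"
  "x \<oplus>\<^bsub>mpoly_ring X\<^esub> y = x + y"
  "\<one>\<^bsub>mpoly_ring X\<^esub> = 1"
  "\<zero>\<^bsub>mpoly_ring X\<^esub> = 0"
  by (simp_all add: mpoly_ring_def)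

lemma mpoly_mult_closed:
  "Poly_Mapping.keys p \<subseteq> expvecs X \<Longrightarrow> Poly_Mapping.keys q \<subseteq> expvecs X \<Longrightarrow>
   Poly_Mapping.keys (p * q) \<subseteq> expvecs X"
  using Poly_Mapping.keys_mult[of p q] expvecs_add[of _ X] by fastforce

lemma mpoly_add_closed:
  "Poly_Mapping.keys p \<subseteq> expvecs X \<Longrightarrow> Poly_Mapping.keys q \<subseteq> expvecs X \<Longrightarrow>
   Poly_Mapping.keys (p + q) \<subseteq> expvecs X"
  using Poly_Mapping.keys_add[of p q] by auto

lemma cring_mpoly_ring: "cring (mpoly_ring X :: 'a::comm_ring_1 mpol ring)"
proof (rule cringI)
  show "abelian_group (mpoly_ring X :: 'a mpol ring)"
  proof (rule abelian_groupI)
    fix p :: "'a mpol"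
    assume "p \<in> carrier (mpoly_ring X)"
    then show "\<exists>q\<in>carrier (mpoly_ring X). q \<oplus>\<^bsub>mpoly_ring X\<^esub> p = \<zero>\<^bsub>mpoly_ring X\<^esub>"
      by (intro bexI[of _ "- p"]) auto
  qed (simp_all add: ac_simps mpoly_add_closed)
  show "comm_monoid (mpoly_ring X :: 'a mpol ring)"
    by (rule comm_monoidI) (simp_all add: ac_simps expvecs_0 mpoly_mult_closed)
qed (simp add: algebra_simps)

lemma poly_subst_superset:
  assumes "finite A" "Poly_Mapping.keys p \<subseteq> A"
  shows "poly_subst \<sigma> p =
     (\<Sum>m\<in>A. const (Poly_Mapping.lookup p m) *
        (\<Prod>v\<in>Poly_Mapping.keys m. \<sigma> v ^ Poly_Mapping.lookup m v))"
  unfolding poly_subst_def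
  by (rule sum.mono_neutral_left) (use assms in \<open>auto simp: in_keys_iff const_def\<close>)

lemma poly_subst_add: "poly_subst \<sigma> (p + q) = poly_subst \<sigma> p + poly_subst \<sigma> q"
proof -
  let ?A = "Poly_Mapping.keys p \<union> Poly_Mapping.keys q"
  have "finite ?A" "Poly_Mapping.keys (p + q) \<subseteq> ?A"
    using Poly_Mapping.keys_add[of p q] by auto
  then show ?thesis
    by (simp add: poly_subst_superset[of ?A] const_def lookup_add single_add
        distrib_right sum.distrib)
qed

lemma poly_subst_var: "poly_subst \<sigma> (var v) = \<sigma> v"
  by (simp add: poly_subst_def var_def monom_def const_def)

lemma poly_subst_const: "poly_subst \<sigma> (const c) = const c"
  by (simp add: poly_subst_def const_def)

lemma exp_subst_superset:
  assumes "finite A" "Poly_Mapping.keys m \<subseteq> A"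
  shows "(\<Prod>v\<in>Poly_Mapping.keys m. \<sigma> v ^ Poly_Mapping.lookup m v) =
     (\<Prod>v\<in>A. (\<sigma> v :: 'a::comm_ring_1 mpol) ^ Poly_Mapping.lookup m v)"
  by (rule prod.mono_neutral_left) (use assms in \<open>auto simp: in_keys_iff\<close>)

lemma exp_subst_add:
  "(\<Prod>v\<in>Poly_Mapping.keys (m + n). (\<sigma> v :: 'a::comm_ring_1 mpol) ^ Poly_Mapping.lookup (m + n) v) =
   (\<Prod>v\<in>Poly_Mapping.keys m. \<sigma> v ^ Poly_Mapping.lookup m v) *
   (\<Prod>v\<in>Poly_Mapping.keys n. \<sigma> v ^ Poly_Mapping.lookup n v)"
proof -
  let ?A = "Poly_Mapping.keys m \<union> Poly_Mapping.keys n"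
  have "finite ?A" "Poly_Mapping.keys (m + n) \<subseteq> ?A"
    using Poly_Mapping.keys_add[of m n] by auto
  then show ?thesis
    by (simp only: exp_subst_superset[of ?A] Un_upper1 Un_upper2)
       (simp add: lookup_add power_add prod.distrib)
qed

lemma poly_subst_single:
  "poly_subst \<sigma> (Poly_Mapping.single m c) =
   const c * (\<Prod>v\<in>Poly_Mapping.keys m. \<sigma> v ^ Poly_Mapping.lookup m v)"
  by (simp add: poly_subst_superset[of "{m}"])

lemma poly_subst_0: "poly_subst \<sigma> 0 = 0"
  by (simp add: poly_subst_def)

lemma poly_subst_sum: "poly_subst \<sigma> (sum f A) = (\<Sum>x\<in>A. poly_subst \<sigma> (f x))"
  by (induction A rule: infinite_finite_induct) (simp_all add: poly_subst_0 poly_subst_add)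

lemma mpol_sum_monomials:
  "(p :: 'a::comm_ring_1 mpol) =
   (\<Sum>m\<in>Poly_Mapping.keys p. Poly_Mapping.single m (Poly_Mapping.lookup p m))"
  by (rule poly_mapping_eqI)
     (simp add: lookup_sum lookup_single when_def in_keys_iff)

lemma poly_subst_mult: "poly_subst \<sigma> (p * q) = poly_subst \<sigma> p * poly_subst \<sigma> q"
proof -
  have single: "poly_subst \<sigma> (Poly_Mapping.single m a * Poly_Mapping.single n b) =
      poly_subst \<sigma> (Poly_Mapping.single m a) * poly_subst \<sigma> (Poly_Mapping.single n b)" for m n a b
  proof -
    have "const (a * b) = const a * const b"
      by (simp add: const_def mult_single)
    then show ?thesis
      by (simp add: mult_single poly_subst_single exp_subst_add mult_ac)
  qed
  have "p * q = (\<Sum>m\<in>Poly_Mapping.keys p. Poly_Mapping.single m (Poly_Mapping.lookup p m)) *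
      (\<Sum>n\<in>Poly_Mapping.keys q. Poly_Mapping.single n (Poly_Mapping.lookup q n))"
    using mpol_sum_monomials[of p] mpol_sum_monomials[of q] by argo
  also have "poly_subst \<sigma> \<dots> =
      poly_subst \<sigma> (\<Sum>m\<in>Poly_Mapping.keys p. Poly_Mapping.single m (Poly_Mapping.lookup p m)) *
      poly_subst \<sigma> (\<Sum>n\<in>Poly_Mapping.keys q. Poly_Mapping.single n (Poly_Mapping.lookup q n))"
    by (simp add: sum_product poly_subst_sum single)
  finally show ?thesis
    using mpol_sum_monomials[of p] mpol_sum_monomials[of q] by argo
qed

lemma poly_subst_closed:
  assumes "Poly_Mapping.keys p \<subseteq> expvecs X"
    and "\<And>v. v \<in> X \<Longrightarrow> Poly_Mapping.keys (\<sigma> v) \<subseteq> expvecs Y"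
  shows "Poly_Mapping.keys (poly_subst \<sigma> p) \<subseteq> expvecs Y"
proof -
  have pow: "Poly_Mapping.keys (\<sigma> v ^ n) \<subseteq> expvecs Y" if "v \<in> X" for v n
    by (induction n) (use that assms(2) in \<open>simp_all add: expvecs_0 mpoly_mult_closed\<close>)
  have prod: "Poly_Mapping.keys (\<Prod>v\<in>A. \<sigma> v ^ f v) \<subseteq> expvecs Y" if "A \<subseteq> X" for A f
    using that by (induction A rule: infinite_finite_induct)
      (simp_all add: expvecs_0 mpoly_mult_closed pow)
  have sum: "Poly_Mapping.keys (\<Sum>m\<in>A. const (c m) *
      (\<Prod>v\<in>Poly_Mapping.keys m. \<sigma> v ^ Poly_Mapping.lookup m v)) \<subseteq> expvecs Y"
    if "A \<subseteq> expvecs X" for A c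
    using that
  proof (induction A rule: infinite_finite_induct)
    case (insert m A)
    then have "Poly_Mapping.keys m \<subseteq> X"
      by (auto simp: expvecs_def)
    with insert show ?case
      by (simp, intro mpoly_add_closed mpoly_mult_closed prod) (auto simp: const_def expvecs_0)
  qed auto
  show ?thesis
    unfolding poly_subst_def by (rule sum) (rule assms(1))
qed

lemma homog_image_ring_hom:
  assumes "\<And>i. i \<in> {1..k} \<Longrightarrow> \<alpha> i \<in> expvecs {1..d}"
  shows "poly_subst (homog_image \<alpha> :: nat \<Rightarrow> 'a::comm_ring_1 mpol)
           \<in> ring_hom (mpoly_ring {0..k}) (mpoly_ring {0..d})"
proof (rule ring_hom_memI)
  have "Poly_Mapping.keys (homog_image \<alpha> v :: 'a mpol) \<subseteq> expvecs {0..d}" if "v \<in> {0..k}" for v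
  proof -
    have 1: "Poly_Mapping.keys (var 0 :: 'a mpol) \<subseteq> expvecs {0..d}"
      by (auto simp: var_def monom_def expvecs_def)
    have "Poly_Mapping.keys (monom (\<alpha> v) :: 'a mpol) \<subseteq> expvecs {0..d}" if "v \<noteq> 0"
      using assms[of v] that \<open>v \<in> {0..k}\<close> by (fastforce simp: monom_def expvecs_def)
    with 1 show ?thesis
      by (cases "v = 0") (simp_all add: homog_image_def mpoly_mult_closed)
  qed
  then show "poly_subst (homog_image \<alpha>) p \<in> carrier (mpoly_ring {0..d})"
    if "p \<in> carrier (mpoly_ring {0..k})" for p :: "'a mpol"
    using that poly_subst_closed[of p "{0..k}" "homog_image \<alpha>"] by auto
  show "poly_subst (homog_image \<alpha>) \<one>\<^bsub>mpoly_ring {0..k}\<^esub> = (\<one>\<^bsub>mpoly_ring {0..d}\<^esub> :: 'a mpol)"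
    using poly_subst_const[of "homog_image \<alpha>" "1::'a"] by (simp add: const_def)
qed (simp_all add: poly_subst_add poly_subst_mult)

end

theory Submission
  imports Defs
begin

text \<open>
  A difference of two monomials lies in a toric ideal iff both have the same image under the exponent
  map, that is, lie in one fibre. Let \<open>g\<close> be an element of the reduced Groebner basis with leading
  monomial \<open>u\<close>. Since the coefficients of \<open>g\<close> sum to zero over each fibre, \<open>g\<close> has a second
  monomial \<open>n\<close> in the fibre of \<open>u\<close>; now \<open>g - (u - n)\<close> lies in the ideal while, by reducedness, none of
  its monomials is divisible by a leading monomial, so \<open>g = u - n\<close>. Cancelling a common factor of \<open>u\<close>
  and \<open>n\<close> would leave a binomial of the ideal whose leading monomial properly divides \<open>u\<close>, so \<open>u\<close>
  and \<open>n\<close> are coprime.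

  In the homogenized case fibres are finite, hence two monomials of one fibre rewrite, modulo the
  basis, to a common monomial. As \<open>t\<close> is the largest variable and the two terms of a basis element are
  coprime, the trailing term is free of \<open>t\<close>. Rewriting \<open>t\<^sup>i y\<^sup>z\<close> and \<open>y\<^sup>w\<close> with \<open>i \<le> j\<close> therefore
  uses only basis elements whose \<open>t\<close>-exponent is at most \<open>j\<close>, and setting \<open>t = 1\<close> along the way
  gives \<open>I\<^sub>j \<subseteq> J\<^sub>j\<close>.
\<close>

subsection \<open>Monomials and exponent vectors\<close>

lemma monom_0 [simp]: "monom 0 = (1 :: 'a::comm_ring_1 mpol)"
  by (simp add: monom_def)

lemma monom_mult: "monom m * monom n = (monom (m + n) :: 'a::comm_ring_1 mpol)"
  by (simp add: monom_def mult_single)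

lemma var_power: "var v ^ n = (monom (Poly_Mapping.single v n) :: 'a::comm_ring_1 mpol)"
  by (induction n) (simp_all add: var_def monom_mult flip: single_add)

lemma monom_power: "monom m ^ n = (monom (of_nat n * m) :: 'a::comm_ring_1 mpol)"
  by (induction n) (simp_all add: monom_mult distrib_right)

lemma prod_monom: "(\<Prod>x\<in>A. monom (f x)) = (monom (\<Sum>x\<in>A. f x) :: 'a::comm_ring_1 mpol)"
  by (induction A rule: infinite_finite_induct) (simp_all add: monom_mult)

lemma lookup_monom:
  "Poly_Mapping.lookup (monom m :: 'a::comm_ring_1 mpol) n = (if m = n then 1 else 0)"
  by (simp add: monom_def lookup_single when_def)

lemma keys_monom_diff:
  "m \<noteq> n \<Longrightarrow> Poly_Mapping.keys (monom m - monom n :: 'a::comm_ring_1 mpol) = {m, n}"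
  by (auto simp: in_keys_iff lookup_minus lookup_monom split: if_splits)

lemma monom_diff_closed:
  "m \<in> expvecs X \<Longrightarrow> n \<in> expvecs X \<Longrightarrow>
    monom m - monom n \<in> carrier (mpoly_ring X :: 'a::comm_ring_1 mpol ring)"
  by (cases "m = n") (simp_all add: keys_monom_diff)

lemma lookup_eq_0_if_expvecs: "m \<in> expvecs X \<Longrightarrow> v \<notin> X \<Longrightarrow> Poly_Mapping.lookup m v = 0"
  by (auto simp: expvecs_def in_keys_iff)

lemma expvecs_add_iff: "m + n \<in> expvecs X \<longleftrightarrow> m \<in> expvecs X \<and> n \<in> expvecs X"
  by (auto simp: expvecs_def in_keys_iff lookup_add subset_iff)

lemma
  assumes "z \<in> expvecs {1..k}"
  shows in_expvecs_atLeast0: "z \<in> expvecs {0..k}"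
    and single_0_add_in_expvecs: "Poly_Mapping.single 0 i + z \<in> expvecs {0..k}"
proof -
  show "z \<in> expvecs {0..k}"
    using assms by (auto simp: expvecs_def)
  then show "Poly_Mapping.single 0 i + z \<in> expvecs {0..k}"
    by (rule expvecs_add[rotated]) (simp add: expvecs_def)
qed

lemma lookup_of_nat_mult:
  "Poly_Mapping.lookup (of_nat n * m) v = n * Poly_Mapping.lookup (m :: expvec) v"
  by (induction n) (simp_all add: distrib_right lookup_add)

definition adds :: "expvec \<Rightarrow> expvec \<Rightarrow> bool" (infix "adds" 50) where
  "m adds n \<longleftrightarrow> (\<exists>q. n = m + q)"

lemma adds_refl: "m adds m"
  by (auto simp: adds_def intro: exI[of _ 0])

lemma adds_add_left: "m adds n \<Longrightarrow> m adds l + n"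
  by (metis adds_def add.left_commute)

lemma total_degree_add: "total_degree (m + n) = total_degree m + total_degree n"
  unfolding total_degree_def by (rule setsum_keys_plus_distrib) simp_all

lemma lookup_le_total_degree: "Poly_Mapping.lookup m v \<le> total_degree m"
  unfolding total_degree_def
  by (cases "v \<in> Poly_Mapping.keys m") (simp_all add: member_le_sum in_keys_iff)

lemma finite_expvecs_total_degree:
  assumes "finite X"
  shows "finite {m \<in> expvecs X. total_degree m = N}" (is "finite ?M")
proof (rule finite_imageD)
  let ?B = "{f. \<forall>v. (v \<in> X \<longrightarrow> f v \<in> {..N}) \<and> (v \<notin> X \<longrightarrow> f v = 0)}"
  have "Poly_Mapping.lookup ` ?M \<subseteq> ?B"
    using lookup_le_total_degree lookup_eq_0_if_expvecs by fastforce
  then show "finite (Poly_Mapping.lookup ` ?M)"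
    by (rule finite_subset) (rule finite_set_of_finite_funs[OF assms finite_atMost])
  show "inj_on Poly_Mapping.lookup ?M"
    by (simp add: inj_on_def lookup_inject)
qed

subsection \<open>Ideals generated by monomials and by binomials\<close>

interpretation mpoly_ring: cring "mpoly_ring X :: 'a::comm_ring_1 mpol ring" for X
  by (rule cring_mpoly_ring)

lemma ideal_mpoly_ringI:
  fixes I :: "'a::comm_ring_1 mpol set"
  assumes closed: "I \<subseteq> carrier (mpoly_ring X)"
    and zero: "0 \<in> I"
    and add: "\<And>p q. p \<in> I \<Longrightarrow> q \<in> I \<Longrightarrow> p + q \<in> I"
    and mult: "\<And>c p. c \<in> carrier (mpoly_ring X) \<Longrightarrow> p \<in> I \<Longrightarrow> c * p \<in> I"
  shows "ideal I (mpoly_ring X)"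
proof (rule idealI)
  show "subgroup I (add_monoid (mpoly_ring X))"
  proof (rule mpoly_ring.add.subgroupI)
    fix p assume "p \<in> I"
    moreover from this have "\<ominus>\<^bsub>mpoly_ring X\<^esub> p = - 1 * p"
      using closed by (intro mpoly_ring.minus_equality) auto
    ultimately show "\<ominus>\<^bsub>mpoly_ring X\<^esub> p \<in> I"
      using mult[of "- 1" p] by (simp add: expvecs_0)
  qed (use closed zero add in auto)
  show "p \<otimes>\<^bsub>mpoly_ring X\<^esub> c \<in> I" if "p \<in> I" "c \<in> carrier (mpoly_ring X)" for p c
    using mult[OF that(2,1)] by (simp add: mult.commute)
qed (use mult in \<open>auto intro: mpoly_ring.ring_axioms\<close>)

lemma
  fixes J :: "'a::comm_ring_1 mpol set"
  assumes "ideal J (mpoly_ring X)"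
  shows mpoly_ideal_zero: "0 \<in> J"
    and mpoly_ideal_add: "p \<in> J \<Longrightarrow> q \<in> J \<Longrightarrow> p + q \<in> J"
    and mpoly_ideal_mult: "c \<in> carrier (mpoly_ring X) \<Longrightarrow> p \<in> J \<Longrightarrow> c * p \<in> J"
    and mpoly_ideal_uminus: "p \<in> J \<Longrightarrow> - p \<in> J"
proof -
  interpret ideal J "mpoly_ring X" by fact
  show "0 \<in> J"
    using additive_subgroup.zero_closed[OF is_additive_subgroup] by simp
  show "p + q \<in> J" if "p \<in> J" "q \<in> J"
    using additive_subgroup.a_closed[OF is_additive_subgroup that] by simp
  show mult: "c * p \<in> J" if "c \<in> carrier (mpoly_ring X)" "p \<in> J" for c p
    using I_l_closed[OF that(2,1)] by simp
  show "- p \<in> J" if "p \<in> J"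
    using mult[OF _ that, of "- 1"] by (simp add: expvecs_0)
qed

definition monomial_ideal :: "nat set \<Rightarrow> expvec set \<Rightarrow> 'a::comm_ring_1 mpol set" where
  "monomial_ideal X U =
     {p \<in> carrier (mpoly_ring X). \<forall>m\<in>Poly_Mapping.keys p. \<exists>u\<in>U. u adds m}"

lemma ideal_monomial_ideal:
  "ideal (monomial_ideal X U :: 'a::comm_ring_1 mpol set) (mpoly_ring X)"
proof (rule ideal_mpoly_ringI)
  fix p q :: "'a mpol"
  assume "p \<in> monomial_ideal X U" "q \<in> monomial_ideal X U"
  then show "p + q \<in> monomial_ideal X U"
    using Poly_Mapping.keys_add[of p q] by (auto simp: monomial_ideal_def)
next
  fix c p :: "'a mpol"
  assume c: "c \<in> carrier (mpoly_ring X)" and p: "p \<in> monomial_ideal X U"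
  have "\<exists>u\<in>U. u adds m" if m: "m \<in> Poly_Mapping.keys (c * p)" for m
  proof -
    obtain a b where "m = a + b" "b \<in> Poly_Mapping.keys p"
      using m Poly_Mapping.keys_mult[of c p] by blast
    then show ?thesis
      using p adds_add_left by (fastforce simp: monomial_ideal_def)
  qed
  then show "c * p \<in> monomial_ideal X U"
    using c p by (simp add: monomial_ideal_def mpoly_mult_closed)
qed (auto simp: monomial_ideal_def)

definition monom_cong :: "'a::comm_ring_1 mpol set \<Rightarrow> expvec \<Rightarrow> expvec \<Rightarrow> bool" where
  "monom_cong J z w \<longleftrightarrow> monom z - monom w \<in> J"

lemma
  fixes J :: "'a::comm_ring_1 mpol set"
  assumes J: "ideal J (mpoly_ring X)"
  shows monom_cong_refl: "monom_cong J z z"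
    and monom_cong_sym: "monom_cong J z w \<Longrightarrow> monom_cong J w z"
    and monom_cong_trans: "monom_cong J z w \<Longrightarrow> monom_cong J w u \<Longrightarrow> monom_cong J z u"
    and monom_cong_add_right: "monom_cong J z w \<Longrightarrow> q \<in> expvecs X \<Longrightarrow> monom_cong J (z + q) (w + q)"
proof -
  show "monom_cong J z z"
    using mpoly_ideal_zero[OF J] by (simp add: monom_cong_def)
  show "monom_cong J z w \<Longrightarrow> monom_cong J w z"
    using mpoly_ideal_uminus[OF J, of "monom z - monom w"] by (simp add: monom_cong_def)
  show "monom_cong J z w \<Longrightarrow> monom_cong J w u \<Longrightarrow> monom_cong J z u"
    using mpoly_ideal_add[OF J, of "monom z - monom w" "monom w - monom u"]
    by (simp add: monom_cong_def)
  assume "monom_cong J z w" "q \<in> expvecs X"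
  then have "monom q * (monom z - monom w) \<in> J"
    unfolding monom_cong_def by (intro mpoly_ideal_mult[OF J]) (simp_all add: monom_def)
  then show "monom_cong J (z + q) (w + q)"
    by (simp add: monom_cong_def right_diff_distrib monom_mult add.commute)
qed

definition binomial_ideal ::
  "nat set \<Rightarrow> (expvec \<Rightarrow> expvec \<Rightarrow> bool) \<Rightarrow> 'a::comm_ring_1 mpol set" where
  "binomial_ideal X R =
     Idl\<^bsub>mpoly_ring X\<^esub> {monom z - monom w | z w. z \<in> expvecs X \<and> w \<in> expvecs X \<and> R z w}"

lemma binomials_in_carrier:
  "{monom z - monom w | z w. z \<in> expvecs X \<and> w \<in> expvecs X \<and> R z w} \<subseteq>
    carrier (mpoly_ring X :: 'a::comm_ring_1 mpol ring)"
  using monom_diff_closed by blast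

lemma ideal_binomial_ideal:
  "ideal (binomial_ideal X R :: 'a::comm_ring_1 mpol set) (mpoly_ring X)"
  unfolding binomial_ideal_def by (rule mpoly_ring.genideal_ideal[OF binomials_in_carrier])

lemma monom_cong_binomial_ideal:
  "z \<in> expvecs X \<Longrightarrow> w \<in> expvecs X \<Longrightarrow> R z w \<Longrightarrow>
    monom_cong (binomial_ideal X R :: 'a::comm_ring_1 mpol set) z w"
  unfolding monom_cong_def binomial_ideal_def
  using mpoly_ring.genideal_self[OF binomials_in_carrier] by blast

lemma binomial_ideal_subsetI:
  fixes J :: "'a::comm_ring_1 mpol set"
  assumes "ideal J (mpoly_ring X)"
    and "\<And>z w. z \<in> expvecs X \<Longrightarrow> w \<in> expvecs X \<Longrightarrow> R z w \<Longrightarrow> monom_cong J z w"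
  shows "binomial_ideal X R \<subseteq> J"
  unfolding binomial_ideal_def
  by (rule mpoly_ring.genideal_minimal) (use assms in \<open>auto simp: monom_cong_def\<close>)

subsection \<open>Monomial orders and leading monomials\<close>

locale monomial_order =
  fixes X :: "nat set" and lt :: "expvec \<Rightarrow> expvec \<Rightarrow> bool" (infix "\<prec>" 50)
  assumes irreflp_lt: "irreflp (\<prec>)" and transp_lt: "transp (\<prec>)"
    and totalp_on_lt: "totalp_on (expvecs X) (\<prec>)"
    and lt_add_right: "m \<prec> n \<Longrightarrow> m + l \<prec> n + l"
    and zero_lt: "m \<in> expvecs X \<Longrightarrow> m \<noteq> 0 \<Longrightarrow> 0 \<prec> m"
begin

lemma not_lt_self: "\<not> m \<prec> m"
  using irreflp_lt by (rule irreflpD)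

lemma lt_trans: "l \<prec> m \<Longrightarrow> m \<prec> n \<Longrightarrow> l \<prec> n"
  using transp_lt by (rule transpD)

lemma asymp_lt: "asymp (\<prec>)"
  using not_lt_self lt_trans by (blast intro: asympI)

lemma lt_linear: "m \<in> expvecs X \<Longrightarrow> n \<in> expvecs X \<Longrightarrow> m \<noteq> n \<Longrightarrow> m \<prec> n \<or> n \<prec> m"
  using totalp_on_lt by (rule totalp_onD)

lemma lt_add_right_cancel:
  assumes "m + l \<prec> n + l" "m \<in> expvecs X" "n \<in> expvecs X"
  shows "m \<prec> n"
proof (rule ccontr)
  assume "\<not> m \<prec> n"
  then have "m = n \<or> n + l \<prec> m + l"
    using assms lt_linear lt_add_right by blast
  with assms(1) show False
    using lt_trans not_lt_self by blast
qed

lemma not_add_lt_self: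
  assumes "l \<in> expvecs X"
  shows "\<not> m + l \<prec> m"
proof (cases "l = 0")
  case False
  then have "m \<prec> m + l"
    using lt_add_right[OF zero_lt[OF assms], of m] by (simp add: add.commute)
  then show ?thesis
    using lt_trans not_lt_self by blast
qed (simp add: not_lt_self)

lemma lead_monom_eqI:
  assumes "m \<in> Poly_Mapping.keys p" "\<And>n. n \<in> Poly_Mapping.keys p \<Longrightarrow> n \<noteq> m \<Longrightarrow> n \<prec> m"
  shows "lead_monom (\<prec>) p = m"
  unfolding lead_monom_def
proof (rule the_equality)
  fix m' assume "m' \<in> Poly_Mapping.keys p \<and> (\<forall>n\<in>Poly_Mapping.keys p. n \<noteq> m' \<longrightarrow> n \<prec> m')"
  then show "m' = m"
    using assms lt_trans not_lt_self by metis
qed (use assms in blast)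

lemma lead_monom_binomial:
  "n \<prec> m \<Longrightarrow> lead_monom (\<prec>) (monom m - monom n :: 'a::comm_ring_1 mpol) = m"
  using not_lt_self keys_monom_diff[of m n] by (intro lead_monom_eqI) auto

lemma
  assumes "p \<in> carrier (mpoly_ring X)" "p \<noteq> 0"
  shows lead_monom_in_keys: "lead_monom (\<prec>) p \<in> Poly_Mapping.keys p"
    and lt_lead_monom: "n \<in> Poly_Mapping.keys p \<Longrightarrow> n \<noteq> lead_monom (\<prec>) p \<Longrightarrow> n \<prec> lead_monom (\<prec>) p"
proof -
  have keys: "Poly_Mapping.keys p \<subseteq> expvecs X" "Poly_Mapping.keys p \<noteq> {}"
    using assms by auto
  then obtain m where m: "m \<in> Poly_Mapping.keys p" "\<forall>n\<in>Poly_Mapping.keys p. n \<noteq> m \<longrightarrow> n \<prec> m"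
    using Finite_Set.bex_greatest_element[of "Poly_Mapping.keys p" "(\<prec>)"] transp_lt
      totalp_on_lt by (meson finite_keys totalp_on_subset transp_on_subset subset_UNIV)
  then have "lead_monom (\<prec>) p = m"
    by (intro lead_monom_eqI) auto
  with m show "lead_monom (\<prec>) p \<in> Poly_Mapping.keys p"
    "n \<in> Poly_Mapping.keys p \<Longrightarrow> n \<noteq> lead_monom (\<prec>) p \<Longrightarrow> n \<prec> lead_monom (\<prec>) p" by auto
qed

lemma lead_monom_in_expvecs:
  "p \<in> carrier (mpoly_ring X) \<Longrightarrow> p \<noteq> 0 \<Longrightarrow> lead_monom (\<prec>) p \<in> expvecs X"
  using lead_monom_in_keys[of p] by auto

lemma lead_terms_in_carrier:
  "F \<subseteq> carrier (mpoly_ring X) \<Longrightarrow> lead_term (\<prec>) ` (F - {0}) \<subseteq> carrier (mpoly_ring X)"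
  using lead_monom_in_expvecs[OF subsetD] by (auto simp: lead_term_def split: if_splits)

lemma monom_in_lead_ideal_iff:
  fixes F :: "'a::field mpol set"
  assumes F: "F \<subseteq> carrier (mpoly_ring X)" and m: "m \<in> expvecs X"
  shows "monom m \<in> lead_ideal X (\<prec>) F \<longleftrightarrow> (\<exists>f\<in>F - {0}. lead_monom (\<prec>) f adds m)"
proof
  have "lead_term (\<prec>) ` (F - {0}) \<subseteq> monomial_ideal X (lead_monom (\<prec>) ` (F - {0}))"
    using lead_terms_in_carrier[OF F] adds_refl
    by (fastforce simp: monomial_ideal_def lead_term_def split: if_splits)
  then have "lead_ideal X (\<prec>) F \<subseteq> monomial_ideal X (lead_monom (\<prec>) ` (F - {0}))"
    unfolding lead_ideal_def by (rule mpoly_ring.genideal_minimal[OF ideal_monomial_ideal])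
  moreover assume "monom m \<in> lead_ideal X (\<prec>) F"
  ultimately have "monom m \<in> (monomial_ideal X (lead_monom (\<prec>) ` (F - {0})) :: 'a mpol set)"
    by blast
  then show "\<exists>f\<in>F - {0}. lead_monom (\<prec>) f adds m"
    by (simp add: monomial_ideal_def monom_def)
next
  assume "\<exists>f\<in>F - {0}. lead_monom (\<prec>) f adds m"
  then obtain f q where f: "f \<in> F" "f \<noteq> 0" and q: "m = lead_monom (\<prec>) f + q"
    by (auto simp: adds_def)
  have "lead_coeff (\<prec>) f \<noteq> 0"
    using lead_monom_in_keys[of f] f F by (auto simp: in_keys_iff lead_coeff_def)
  then have "monom m = Poly_Mapping.single q (1 / lead_coeff (\<prec>) f) * lead_term (\<prec>) f"
    by (simp add: q lead_term_def mult_single monom_def add.commute)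
  moreover have "Poly_Mapping.single q (1 / lead_coeff (\<prec>) f) \<in> carrier (mpoly_ring X)"
    using m q by (simp add: expvecs_add_iff)
  moreover have "lead_term (\<prec>) f \<in> lead_ideal X (\<prec>) F"
    unfolding lead_ideal_def
    using mpoly_ring.genideal_self[OF lead_terms_in_carrier[OF F]] f by blast
  ultimately show "monom m \<in> lead_ideal X (\<prec>) F"
    using mpoly_ideal_mult[OF mpoly_ring.genideal_ideal[OF lead_terms_in_carrier[OF F]]]
    by (simp add: lead_ideal_def)
qed

lemma groebner_basis_lead_monom_adds:
  assumes "groebner_basis X (\<prec>) I G" "I \<subseteq> carrier (mpoly_ring X)" "f \<in> I" "f \<noteq> 0"
  shows "\<exists>g\<in>G - {0}. lead_monom (\<prec>) g adds lead_monom (\<prec>) f"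
proof -
  have f: "lead_monom (\<prec>) f \<in> expvecs X"
    using assms lead_monom_in_expvecs by blast
  have "monom (lead_monom (\<prec>) f) \<in> lead_ideal X (\<prec>) I"
    using assms monom_in_lead_ideal_iff[OF _ f] adds_refl by blast
  then show ?thesis
    using assms monom_in_lead_ideal_iff[OF _ f, of G] by (auto simp: groebner_basis_def)
qed

lemma reduced_groebner_basis_adds_key_unique:
  assumes reduced: "reduced_groebner_basis X (\<prec>) I G" and I: "I \<subseteq> carrier (mpoly_ring X)"
    and g: "g \<in> G" "m \<in> Poly_Mapping.keys g" and h: "h \<in> G" "lead_monom (\<prec>) h adds m"
  shows "h = g"
proof (rule ccontr)
  assume "h \<noteq> g"
  have G: "G \<subseteq> carrier (mpoly_ring X)"
    using reduced I by (auto simp: reduced_groebner_basis_def groebner_basis_def)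
  have "h \<in> G - {g} - {0}"
    using reduced h \<open>h \<noteq> g\<close> by (auto simp: reduced_groebner_basis_def)
  then have "monom m \<in> lead_ideal X (\<prec>) (G - {g})"
    using monom_in_lead_ideal_iff[of "G - {g}" m] G g h by auto
  with reduced g show False
    by (simp add: reduced_groebner_basis_def)
qed

lemma reduced_groebner_basis_tail_eq_0:
  assumes reduced: "reduced_groebner_basis X (\<prec>) I G" and I: "I \<subseteq> carrier (mpoly_ring X)"
    and g: "g \<in> G" and h: "h \<in> I" "Poly_Mapping.keys h \<subseteq> Poly_Mapping.keys g - {lead_monom (\<prec>) g}"
  shows "h = 0"
proof (rule ccontr)
  assume "h \<noteq> 0"
  have groebner: "groebner_basis X (\<prec>) I G" and "g \<noteq> 0"
    using reduced g by (auto simp: reduced_groebner_basis_def)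
  have carrier: "g \<in> carrier (mpoly_ring X)" "h \<in> carrier (mpoly_ring X)"
    using groebner I g h(1) by (auto simp: groebner_basis_def)
  let ?u = "lead_monom (\<prec>) g"
  let ?m = "lead_monom (\<prec>) h"
  have m: "?m \<in> Poly_Mapping.keys g" "?m \<noteq> ?u"
    using lead_monom_in_keys[OF carrier(2) \<open>h \<noteq> 0\<close>] h(2) by blast+
  obtain g' where g': "g' \<in> G" "lead_monom (\<prec>) g' adds ?m"
    using groebner_basis_lead_monom_adds[OF groebner I h(1) \<open>h \<noteq> 0\<close>] by blast
  have "g' = g"
    using reduced_groebner_basis_adds_key_unique[OF reduced I g m(1) g'] .
  with g'(2) obtain q where q: "?m = ?u + q"
    by (auto simp: adds_def)
  then have "q \<in> expvecs X"
    using m(1) carrier(1) expvecs_add_iff[of ?u q X] by auto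
  with q show False
    using lt_lead_monom[OF carrier(1) \<open>g \<noteq> 0\<close> m] not_add_lt_self[of q ?u] by simp
qed

end

locale lex_order =
  fixes X :: "nat set" and r :: "nat rel"
  assumes finite_X: "finite X" and linear: "linear_order_on X r"
begin

lemma r_trans: "(u, v) \<in> r \<Longrightarrow> (v, w) \<in> r \<Longrightarrow> (u, w) \<in> r"
  using linear unfolding order_on_defs by (elim conjE) (rule transD)

lemma r_antisym: "(u, v) \<in> r \<Longrightarrow> (v, u) \<in> r \<Longrightarrow> u = v"
  using linear unfolding order_on_defs by (elim conjE) (rule antisymD)

lemma r_linear: "u \<in> X \<Longrightarrow> v \<in> X \<Longrightarrow> (u, v) \<in> r \<or> (v, u) \<in> r"
  using linear unfolding order_on_defs by (metis refl_onD total_on_def)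

lemma lex_less_trans:
  assumes "lex_less X r l m" "lex_less X r m n"
  shows "lex_less X r l n"
proof -
  from assms(1) obtain v where v: "v \<in> X" "Poly_Mapping.lookup l v < Poly_Mapping.lookup m v"
    "\<forall>u\<in>X. (v, u) \<in> r \<and> u \<noteq> v \<longrightarrow> Poly_Mapping.lookup l u = Poly_Mapping.lookup m u"
    unfolding lex_less_def by blast
  from assms(2) obtain w where w: "w \<in> X" "Poly_Mapping.lookup m w < Poly_Mapping.lookup n w"
    "\<forall>u\<in>X. (w, u) \<in> r \<and> u \<noteq> w \<longrightarrow> Poly_Mapping.lookup m u = Poly_Mapping.lookup n u"
    unfolding lex_less_def by blast
  obtain x where x: "x = v \<or> x = w" "(v, x) \<in> r" "(w, x) \<in> r"
    using r_linear v(1) w(1) by metis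
  then have "x \<in> X"
    using v(1) w(1) by auto
  moreover have "Poly_Mapping.lookup l x < Poly_Mapping.lookup n x"
    using v(2,3) w(2,3) x \<open>x \<in> X\<close> by (cases "x = v"; cases "x = w") auto
  moreover have "Poly_Mapping.lookup l u = Poly_Mapping.lookup n u"
    if "u \<in> X" "(x, u) \<in> r" "u \<noteq> x" for u
  proof -
    have "(v, u) \<in> r" "(w, u) \<in> r"
      using x that r_trans by blast+
    moreover have "u \<noteq> v" "u \<noteq> w"
      using x that r_antisym by blast+
    ultimately show ?thesis
      using v(3) w(3) that(1) by simp
  qed
  ultimately show ?thesis
    unfolding lex_less_def by blast
qed

lemma lex_less_linear:
  assumes "m \<in> expvecs X" "n \<in> expvecs X" "m \<noteq> n"
  shows "lex_less X r m n \<or> lex_less X r n m"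
proof -
  let ?D = "{v \<in> X. Poly_Mapping.lookup m v \<noteq> Poly_Mapping.lookup n v}"
  have "?D \<noteq> {}"
  proof
    assume "?D = {}"
    then have "Poly_Mapping.lookup m v = Poly_Mapping.lookup n v" for v
      using assms(1,2) lookup_eq_0_if_expvecs[of _ X v] by (cases "v \<in> X") auto
    with assms(3) show False
      by (auto intro: poly_mapping_eqI)
  qed
  moreover have "transp_on ?D (\<lambda>u v. (u, v) \<in> r - Id)"
    using r_trans r_antisym by (intro transp_onI) blast
  moreover have "totalp_on ?D (\<lambda>u v. (u, v) \<in> r - Id)"
    using r_linear by (intro totalp_onI) blast
  ultimately obtain w where w: "w \<in> ?D" "\<forall>u\<in>?D. u \<noteq> w \<longrightarrow> (u, w) \<in> r - Id"
    using Finite_Set.bex_greatest_element[of ?D "\<lambda>u v. (u, v) \<in> r - Id"] finite_X by auto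
  then have "Poly_Mapping.lookup m u = Poly_Mapping.lookup n u"
    if "u \<in> X" "(w, u) \<in> r" "u \<noteq> w" for u
    using that r_antisym by blast
  then show ?thesis
    using w(1) unfolding lex_less_def by (auto simp: nat_neq_iff)
qed

sublocale monomial_order X "lex_less X r"
proof
  show "irreflp (lex_less X r)"
    by (simp add: irreflp_on_def lex_less_def)
  show "transp (lex_less X r)"
    using lex_less_trans by (rule transpI)
  show "totalp_on (expvecs X) (lex_less X r)"
    using lex_less_linear by (rule totalp_onI)
  show "lex_less X r (m + l) (n + l)" if "lex_less X r m n" for l m n
    using that by (simp add: lex_less_def lookup_add)
  show "lex_less X r 0 m" if "m \<in> expvecs X" "m \<noteq> 0" for m
    using lex_less_linear[of 0 m] that by (auto simp: expvecs_0 lex_less_def)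
qed

lemma lex_less_imp_lookup_greatest_le:
  assumes "lex_less X r m n" "x \<in> X" "\<And>v. v \<in> X \<Longrightarrow> (v, x) \<in> r"
  shows "Poly_Mapping.lookup m x \<le> Poly_Mapping.lookup n x"
proof -
  from assms(1) obtain v where v: "v \<in> X" "Poly_Mapping.lookup m v < Poly_Mapping.lookup n v"
    "\<forall>u\<in>X. (v, u) \<in> r \<and> u \<noteq> v \<longrightarrow> Poly_Mapping.lookup m u = Poly_Mapping.lookup n u"
    unfolding lex_less_def by blast
  then show ?thesis
    using assms(2,3) by (cases "x = v") auto
qed

end


subsection \<open>Toric ideals\<close>

definition map_monoms :: "(expvec \<Rightarrow> 'b) \<Rightarrow> 'a::comm_ring_1 mpol \<Rightarrow> 'b \<Rightarrow>\<^sub>0 'a" where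
  "map_monoms \<phi> p =
     (\<Sum>m\<in>Poly_Mapping.keys p. Poly_Mapping.single (\<phi> m) (Poly_Mapping.lookup p m))"

lemma map_monoms_add: "map_monoms \<phi> (p + q) = map_monoms \<phi> p + map_monoms \<phi> q"
  unfolding map_monoms_def by (rule setsum_keys_plus_distrib) (simp_all add: single_add)

lemma map_monoms_diff: "map_monoms \<phi> (p - q) = map_monoms \<phi> p - map_monoms \<phi> q"
  using map_monoms_add[of \<phi> "p - q" q] by (simp add: algebra_simps)

lemma map_monoms_monom: "map_monoms \<phi> (monom m) = Poly_Mapping.single (\<phi> m) (1 :: 'a::comm_ring_1)"
  by (simp add: map_monoms_def monom_def)

lemma lookup_map_monoms:
  "Poly_Mapping.lookup (map_monoms \<phi> p) e =
    (\<Sum>m | m \<in> Poly_Mapping.keys p \<and> \<phi> m = e. Poly_Mapping.lookup p m)"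
  by (simp add: map_monoms_def lookup_sum lookup_single when_def sum.If_cases Int_def)

definition toric_ideal :: "nat set \<Rightarrow> (expvec \<Rightarrow> 'b) \<Rightarrow> 'a::comm_ring_1 mpol set" where
  "toric_ideal X \<phi> = {p \<in> carrier (mpoly_ring X). map_monoms \<phi> p = 0}"

lemma toric_ideal_subset_carrier: "toric_ideal X \<phi> \<subseteq> carrier (mpoly_ring X)"
  by (auto simp: toric_ideal_def)

lemma toric_ideal_diff: "p \<in> toric_ideal X \<phi> \<Longrightarrow> q \<in> toric_ideal X \<phi> \<Longrightarrow> p - q \<in> toric_ideal X \<phi>"
  using mpoly_add_closed[of p X "- q"] by (auto simp: toric_ideal_def map_monoms_diff)

lemma monom_diff_in_toric_ideal_iff:
  assumes "m \<in> expvecs X" "n \<in> expvecs X"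
  shows "monom m - monom n \<in> (toric_ideal X \<phi> :: 'a::comm_ring_1 mpol set) \<longleftrightarrow> \<phi> m = \<phi> n"
proof -
  have "Poly_Mapping.single (\<phi> m) (1 :: 'a) = Poly_Mapping.single (\<phi> n) 1 \<longleftrightarrow> \<phi> m = \<phi> n"
    by (metis keys_single singleton_inject zero_neq_one)
  then show ?thesis
    using monom_diff_closed[OF assms, where 'a = 'a]
    by (simp add: toric_ideal_def map_monoms_diff map_monoms_monom)
qed

lemma toric_ideal_key_shares_fibre:
  assumes "p \<in> toric_ideal X \<phi>" "m \<in> Poly_Mapping.keys p"
  obtains n where "n \<in> Poly_Mapping.keys p" "n \<noteq> m" "\<phi> n = \<phi> m"
proof (rule ccontr)
  assume "\<not> thesis"
  with assms(2) that have "{n. n \<in> Poly_Mapping.keys p \<and> \<phi> n = \<phi> m} = {m}"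
    by auto
  then have "Poly_Mapping.lookup (map_monoms \<phi> p) (\<phi> m) = Poly_Mapping.lookup p m"
    by (simp add: lookup_map_monoms)
  with assms show False
    by (simp add: toric_ideal_def in_keys_iff)
qed

locale toric_groebner = monomial_order X lt
  for X :: "nat set" and lt :: "expvec \<Rightarrow> expvec \<Rightarrow> bool" (infix "\<prec>" 50) +
  fixes \<phi> :: "expvec \<Rightarrow> 'b::cancel_comm_monoid_add" and G :: "'a::field mpol set"
  assumes \<phi>_add: "\<phi> (m + n) = \<phi> m + \<phi> n"
    and reduced: "reduced_groebner_basis X (\<prec>) (toric_ideal X \<phi>) G"
begin

lemma G_subset_toric_ideal: "G \<subseteq> toric_ideal X \<phi>"
  and G_groebner_basis: "groebner_basis X (\<prec>) (toric_ideal X \<phi>) G"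
  using reduced by (simp_all add: reduced_groebner_basis_def groebner_basis_def)

lemmas adds_key_unique =
  reduced_groebner_basis_adds_key_unique[OF reduced toric_ideal_subset_carrier]

lemma basis_element_binomial:
  assumes g: "g \<in> G"
  obtains n where "n \<prec> lead_monom (\<prec>) g" "g = monom (lead_monom (\<prec>) g) - monom n"
proof -
  let ?u = "lead_monom (\<prec>) g"
  have carrier: "g \<in> carrier (mpoly_ring X)"
    using g G_subset_toric_ideal toric_ideal_subset_carrier by blast
  have "g \<noteq> 0" and lead_coeff_1: "Poly_Mapping.lookup g ?u = 1"
    using g reduced by (auto simp: reduced_groebner_basis_def lead_coeff_def)
  note lead_key = lead_monom_in_keys[OF carrier \<open>g \<noteq> 0\<close>]
  obtain n where n: "n \<in> Poly_Mapping.keys g" "n \<noteq> ?u" "\<phi> n = \<phi> ?u"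
    using toric_ideal_key_shares_fibre[of g X \<phi> ?u] g lead_key G_subset_toric_ideal by blast
  let ?h = "g - (monom ?u - monom n)"
  have "monom ?u - monom n \<in> (toric_ideal X \<phi> :: 'a mpol set)"
    using lead_key n carrier by (subst monom_diff_in_toric_ideal_iff) auto
  then have "?h \<in> toric_ideal X \<phi>"
    using g G_subset_toric_ideal by (auto intro: toric_ideal_diff)
  moreover have "Poly_Mapping.keys ?h \<subseteq> Poly_Mapping.keys g - {?u}"
    using n lead_coeff_1 by (auto simp: in_keys_iff lookup_minus lookup_monom split: if_splits)
  ultimately have "?h = 0"
    by (rule reduced_groebner_basis_tail_eq_0[OF reduced toric_ideal_subset_carrier g])
  then show thesis
    using that lt_lead_monom[OF carrier \<open>g \<noteq> 0\<close> n(1,2)] by simp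
qed

definition rewrite_rule :: "expvec \<Rightarrow> expvec \<Rightarrow> bool" where
  "rewrite_rule u v \<longleftrightarrow> monom u - monom v \<in> G \<and> v \<prec> u"

lemma rewrite_rule_sound:
  assumes "rewrite_rule u v"
  shows "u \<in> expvecs X" "v \<in> expvecs X" "\<phi> u = \<phi> v"
proof -
  have G: "monom u - monom v \<in> (toric_ideal X \<phi> :: 'a mpol set)"
    using assms G_subset_toric_ideal unfolding rewrite_rule_def by blast
  have "u \<noteq> v"
    using assms not_lt_self by (auto simp: rewrite_rule_def)
  then have "{u, v} \<subseteq> expvecs X"
    using G keys_monom_diff[of u v, where 'a = 'a] by (simp add: toric_ideal_def)
  then show in_X: "u \<in> expvecs X" "v \<in> expvecs X"
    by simp_all
  show "\<phi> u = \<phi> v"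
    using G monom_diff_in_toric_ideal_iff[OF in_X] by blast
qed

lemma nonminimal_imp_rewritable:
  assumes "m \<in> expvecs X" "n \<in> expvecs X" "\<phi> n = \<phi> m" "n \<prec> m"
  obtains u v where "rewrite_rule u v" "u adds m"
proof -
  let ?p = "monom m - monom n :: 'a mpol"
  have "m \<noteq> n"
    using assms(4) not_lt_self by blast
  then have "?p \<noteq> 0"
    using keys_monom_diff[of m n, where 'a = 'a] by auto
  moreover have "?p \<in> toric_ideal X \<phi>"
    using assms monom_diff_in_toric_ideal_iff by metis
  ultimately obtain g where g: "g \<in> G" "lead_monom (\<prec>) g adds m"
    using groebner_basis_lead_monom_adds[OF G_groebner_basis toric_ideal_subset_carrier]
      lead_monom_binomial[OF assms(4), where 'a = 'a] by (metis DiffD1)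
  obtain v where "v \<prec> lead_monom (\<prec>) g" "g = monom (lead_monom (\<prec>) g) - monom v"
    by (rule basis_element_binomial[OF g(1)])
  then have "rewrite_rule (lead_monom (\<prec>) g) v"
    using g(1) by (simp add: rewrite_rule_def)
  with g(2) show thesis
    using that by blast
qed

lemma rewrite_rule_coprime:
  assumes rule: "rewrite_rule (u + e) (v + e)"
  shows "e = 0"
proof -
  let ?g = "monom (u + e) - monom (v + e) :: 'a mpol"
  have g: "?g \<in> G" and lt: "v + e \<prec> u + e"
    using rule by (simp_all add: rewrite_rule_def)
  have "u \<in> expvecs X" "v \<in> expvecs X" "\<phi> v = \<phi> u"
    using rewrite_rule_sound[OF rule] by (simp_all add: expvecs_add_iff \<phi>_add)
  moreover from this have "v \<prec> u"
    using lt lt_add_right_cancel by blast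
  ultimately obtain u' v' where rule': "rewrite_rule u' v'" and "u' adds u"
    using nonminimal_imp_rewritable by blast
  then obtain q where u: "u = u' + q"
    by (auto simp: adds_def)
  have "u + e \<in> Poly_Mapping.keys ?g"
    using lt not_lt_self keys_monom_diff[of "u + e" "v + e", where 'a = 'a] by auto
  moreover have lead: "lead_monom (\<prec>) (monom u' - monom v' :: 'a mpol) = u'"
    using rule' by (intro lead_monom_binomial) (simp add: rewrite_rule_def)
  ultimately have "monom u' - monom v' = ?g"
    using adds_key_unique[OF g, of "u + e" "monom u' - monom v'"] rule' u
    by (auto simp: rewrite_rule_def adds_def add.assoc)
  then have "u' = u + e"
    using lead lead_monom_binomial[OF lt, where 'a = 'a] by simp
  with u have "e + q = 0"
    by (simp add: add.assoc)
  then have "Poly_Mapping.lookup e x + Poly_Mapping.lookup q x = 0" for x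
    by (simp flip: lookup_add)
  then show "e = 0"
    by (intro poly_mapping_eqI) simp
qed

inductive reduces :: "expvec \<Rightarrow> expvec \<Rightarrow> bool" where
  "rewrite_rule u v \<Longrightarrow> reduces (u + q) (v + q)"

lemma reduces_lt: "reduces m n \<Longrightarrow> n \<prec> m"
  by (auto simp: reduces.simps rewrite_rule_def intro: lt_add_right)

lemma reduces_fibre:
  "reduces m n \<Longrightarrow> m \<in> expvecs X \<Longrightarrow> n \<in> expvecs X \<and> \<phi> n = \<phi> m"
  by (auto simp: reduces.simps expvecs_add_iff \<phi>_add dest: rewrite_rule_sound)

lemma rtranclp_reduces_fibre:
  "reduces\<^sup>*\<^sup>* m n \<Longrightarrow> m \<in> expvecs X \<Longrightarrow> n \<in> expvecs X \<and> \<phi> n = \<phi> m"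
  by (induction rule: rtranclp_induct) (auto dest: reduces_fibre)

lemma ex_irreducible_reduct:
  assumes m: "m \<in> expvecs X" and finite_fibre: "finite {n \<in> expvecs X. \<phi> n = \<phi> m}"
  obtains n where "reduces\<^sup>*\<^sup>* m n" "\<And>n'. \<not> reduces n n'"
proof -
  let ?R = "{n. reduces\<^sup>*\<^sup>* m n}"
  have "finite ?R" "?R \<noteq> {}"
    using finite_subset[OF _ finite_fibre, of ?R] rtranclp_reduces_fibre[OF _ m] by blast+
  moreover have "asymp_on ?R (\<prec>)" "transp_on ?R (\<prec>)"
    using asymp_lt transp_lt by (auto intro: asymp_on_subset transp_on_subset)
  ultimately have "\<exists>n\<in>?R. \<forall>n'\<in>?R. n' \<noteq> n \<longrightarrow> \<not> n' \<prec> n"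
    by (intro Finite_Set.bex_min_element)
  then obtain n where n: "n \<in> ?R" "\<forall>n'\<in>?R. n' \<noteq> n \<longrightarrow> \<not> n' \<prec> n" ..
  have "\<not> reduces n n'" for n'
    using n reduces_lt[of n n'] not_lt_self by (auto dest: rtranclp.rtrancl_into_rtrancl)
  with n(1) show thesis
    using that by blast
qed

lemma irreducible_unique:
  assumes in_X: "m \<in> expvecs X" "n \<in> expvecs X" and fibre: "\<phi> m = \<phi> n"
    and irreducible: "\<And>l. \<not> reduces m l" "\<And>l. \<not> reduces n l"
  shows "m = n"
proof -
  have "\<not> n \<prec> m"
    using nonminimal_imp_rewritable[OF in_X fibre[symmetric]] irreducible(1)
    by (metis adds_def reduces.intros)
  moreover have "\<not> m \<prec> n"
    using nonminimal_imp_rewritable[OF in_X(2,1) fibre] irreducible(2)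
    by (metis adds_def reduces.intros)
  ultimately show ?thesis
    using lt_linear[OF in_X] by blast
qed

lemma fibre_joinable:
  assumes "m \<in> expvecs X" "n \<in> expvecs X" "\<phi> m = \<phi> n" "finite {l \<in> expvecs X. \<phi> l = \<phi> n}"
  obtains l where "reduces\<^sup>*\<^sup>* m l" "reduces\<^sup>*\<^sup>* n l"
proof -
  obtain m' where m': "reduces\<^sup>*\<^sup>* m m'" "\<And>l. \<not> reduces m' l"
    using ex_irreducible_reduct[of m] assms by auto
  obtain n' where n': "reduces\<^sup>*\<^sup>* n n'" "\<And>l. \<not> reduces n' l"
    using ex_irreducible_reduct[of n] assms by auto
  have "m' = n'"
    using irreducible_unique[OF _ _ _ m'(2) n'(2)] rtranclp_reduces_fibre[OF m'(1)]
      rtranclp_reduces_fibre[OF n'(1)] assms by simp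
  with m'(1) n'(1) show thesis
    using that by blast
qed

end

subsection \<open>The homogenized toric ideal\<close>

text \<open>
  On exponent vectors \<open>(*)\<close> is convolution, so that \<open>of_nat n * b\<close> is the \<open>n\<close>-fold sum of \<open>b\<close>.
\<close>

definition exponent_map :: "(nat \<Rightarrow> expvec) \<Rightarrow> expvec \<Rightarrow> expvec" where
  "exponent_map a m = (\<Sum>v\<in>Poly_Mapping.keys m. of_nat (Poly_Mapping.lookup m v) * a v)"

lemma exponent_map_add: "exponent_map a (m + n) = exponent_map a m + exponent_map a n"
  unfolding exponent_map_def by (rule setsum_keys_plus_distrib) (simp_all add: distrib_right)

lemma exponent_map_cong:
  "m \<in> expvecs X \<Longrightarrow> (\<And>v. v \<in> X \<Longrightarrow> a v = b v) \<Longrightarrow> exponent_map a m = exponent_map b m"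
  unfolding exponent_map_def by (rule sum.cong) (auto simp: expvecs_def)

lemma lookup_exponent_map:
  assumes "m \<in> expvecs X" "finite X"
  shows "Poly_Mapping.lookup (exponent_map a m) c =
    (\<Sum>v\<in>X. Poly_Mapping.lookup m v * Poly_Mapping.lookup (a v) c)"
  unfolding exponent_map_def lookup_sum lookup_of_nat_mult
  by (rule sum.mono_neutral_left) (use assms in \<open>auto simp: expvecs_def in_keys_iff\<close>)

lemma exponent_map_in_submonoid_span:
  assumes "m \<in> expvecs X"
  shows "exponent_map a m \<in> submonoid_span (a ` X)"
proof -
  have multiple: "of_nat n * b \<in> submonoid_span S" if "b \<in> S" for n b S
    by (induction n) (use that in \<open>simp_all add: distrib_right submonoid_span.intros\<close>)
  have "(\<Sum>v\<in>A. of_nat (f v) * a v) \<in> submonoid_span (a ` X)" if "A \<subseteq> X" for A f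
    using that by (induction A rule: infinite_finite_induct)
      (auto intro: submonoid_span.zero submonoid_span.add multiple)
  with assms show ?thesis
    by (simp add: exponent_map_def expvecs_def)
qed

lemma poly_subst_monom_eq_map_monoms:
  "poly_subst (\<lambda>v. monom (a v)) p = map_monoms (exponent_map a) (p :: 'a::comm_ring_1 mpol)"
  unfolding poly_subst_def map_monoms_def
  by (rule sum.cong)
    (simp_all add: monom_power prod_monom flip: exponent_map_def,
      simp add: const_def monom_def mult_single)

lemma factorizations_eq: "factorizations k \<alpha> \<gamma> = {z \<in> expvecs {1..k}. exponent_map \<alpha> z = \<gamma>}"
  by (auto simp: factorizations_def poly_mapping_eq_iff fun_eq_iff lookup_exponent_map)

text \<open>
  The exponents of the image of a monomial under \<open>t \<mapsto> s\<^sub>0\<close>, \<open>y\<^sub>i \<mapsto> s\<^sub>0 s\<^bsup>\<alpha> i\<^esup>\<close>: the update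
  \<open>\<alpha>(0 := 0)\<close> discards the junk value \<open>\<alpha> 0\<close>, as \<open>t\<close> is mapped to \<open>s\<^sub>0\<close> alone.
\<close>

definition homog_exp :: "(nat \<Rightarrow> expvec) \<Rightarrow> expvec \<Rightarrow> expvec" where
  "homog_exp \<alpha> m = Poly_Mapping.single 0 (total_degree m) + exponent_map (\<alpha>(0 := 0)) m"

lemma homog_exp_add: "homog_exp \<alpha> (m + n) = homog_exp \<alpha> m + homog_exp \<alpha> n"
  by (simp add: homog_exp_def total_degree_add exponent_map_add single_add ac_simps)

lemma exponent_map_homog:
  "exponent_map (\<lambda>v. Poly_Mapping.single 0 1 + (\<alpha>(0 := 0)) v) = homog_exp \<alpha>"
proof
  fix m
  have "of_nat n * Poly_Mapping.single 0 1 = (Poly_Mapping.single 0 n :: expvec)" for n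
    by (simp add: of_nat_single mult_single)
  then have "(\<Sum>v\<in>Poly_Mapping.keys m. of_nat (Poly_Mapping.lookup m v) * Poly_Mapping.single 0 1) =
      (Poly_Mapping.single 0 (total_degree m) :: expvec)"
    using sum_comp_morphism[of "Poly_Mapping.single 0" "Poly_Mapping.lookup m" "Poly_Mapping.keys m"]
    by (simp add: total_degree_def single_add comp_def)
  then show "exponent_map (\<lambda>v. Poly_Mapping.single 0 1 + (\<alpha>(0 := 0)) v) m = homog_exp \<alpha> m"
    by (simp add: homog_exp_def exponent_map_def distrib_left sum.distrib del: fun_upd_apply)
qed

lemma homog_toric_ideal_eq:
  "homog_toric_ideal d k \<alpha> = (toric_ideal {0..k} (homog_exp \<alpha>) :: 'a::field mpol set)"
proof -
  have "(homog_image \<alpha> :: nat \<Rightarrow> 'a mpol) = (\<lambda>v. monom (Poly_Mapping.single 0 1 + (\<alpha>(0 := 0)) v))"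
    by (auto simp: homog_image_def var_def monom_mult)
  then have "poly_subst (homog_image \<alpha>) = (map_monoms (homog_exp \<alpha>) :: 'a mpol \<Rightarrow> 'a mpol)"
    by (intro ext) (simp only: poly_subst_monom_eq_map_monoms exponent_map_homog)
  then show ?thesis
    by (simp add: homog_toric_ideal_def a_kernel_def kernel_def toric_ideal_def)
qed

lemma homog_exp_eq_iff:
  assumes generators: "\<alpha> ` {1..k} \<subseteq> expvecs {1..d}"
    and m: "m \<in> expvecs {0..k}" and n: "n \<in> expvecs {0..k}"
  shows "homog_exp \<alpha> m = homog_exp \<alpha> n \<longleftrightarrow>
    total_degree m = total_degree n \<and> exponent_map (\<alpha>(0 := 0)) m = exponent_map (\<alpha>(0 := 0)) n"
proof
  have "Poly_Mapping.lookup (\<alpha> v) 0 = 0" if "v \<in> {1..k}" for v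
    using generators that by (intro lookup_eq_0_if_expvecs[of _ "{1..d}"]) auto
  then have "Poly_Mapping.lookup ((\<alpha>(0 := 0)) v) 0 = 0" if "v \<in> {0..k}" for v
    using that by simp
  then have "Poly_Mapping.lookup (homog_exp \<alpha> l) 0 = total_degree l" if "l \<in> expvecs {0..k}" for l
    by (simp add: homog_exp_def lookup_add lookup_exponent_map[OF that] del: fun_upd_apply)
  moreover assume eq: "homog_exp \<alpha> m = homog_exp \<alpha> n"
  ultimately have "total_degree m = total_degree n"
    using m n by metis
  with eq show "total_degree m = total_degree n \<and>
      exponent_map (\<alpha>(0 := 0)) m = exponent_map (\<alpha>(0 := 0)) n"
    by (simp add: homog_exp_def)
qed (simp add: homog_exp_def)

lemma homog_exp_single_add_eq_iff:
  assumes generators: "\<alpha> ` {1..k} \<subseteq> expvecs {1..d}"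
    and z: "z \<in> expvecs {1..k}" and w: "w \<in> expvecs {1..k}"
  shows "homog_exp \<alpha> (Poly_Mapping.single 0 i + z) = homog_exp \<alpha> w \<longleftrightarrow>
    i + total_degree z = total_degree w \<and> exponent_map \<alpha> z = exponent_map \<alpha> w"
proof -
  have "Poly_Mapping.single 0 i + z \<in> expvecs {0..k}" "w \<in> expvecs {0..k}"
    using z w by (simp_all add: single_0_add_in_expvecs in_expvecs_atLeast0)
  moreover have "total_degree (Poly_Mapping.single 0 i + z) = i + total_degree z"
    by (simp add: total_degree_add) (simp add: total_degree_def)
  moreover have "exponent_map (\<alpha>(0 := 0)) (Poly_Mapping.single 0 i) = 0"
    by (simp add: exponent_map_def)
  moreover have "exponent_map (\<alpha>(0 := 0)) l = exponent_map \<alpha> l" if "l \<in> expvecs {1..k}" for l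
    by (rule exponent_map_cong[OF that]) simp
  ultimately show ?thesis
    using z w by (simp add: homog_exp_eq_iff[OF generators] exponent_map_add)
qed

lemma finite_homog_exp_fibre:
  assumes generators: "\<alpha> ` {1..k} \<subseteq> expvecs {1..d}" and m: "m \<in> expvecs {0..k}"
  shows "finite {n \<in> expvecs {0..k}. homog_exp \<alpha> n = homog_exp \<alpha> m}"
  by (rule finite_subset[OF _ finite_expvecs_total_degree[of "{0..k}" "total_degree m"]])
    (use homog_exp_eq_iff[OF generators _ m] in auto)

subsection \<open>Factorizations and the Groebner basis\<close>

lemma length_diff_ideal_eq:
  assumes "submonoid_span (\<alpha> ` {1..k}) = \<Gamma>"
  shows "length_diff_ideal k \<alpha> \<Gamma> j = (binomial_ideal {1..k} (\<lambda>z w.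
    exponent_map \<alpha> z = exponent_map \<alpha> w \<and>
    \<bar>int (total_degree w) - int (total_degree z)\<bar> \<le> int j) :: 'a::field mpol set)"
proof -
  have "(\<exists>\<gamma>. \<gamma> \<in> \<Gamma> \<and> z \<in> factorizations k \<alpha> \<gamma> \<and> w \<in> factorizations k \<alpha> \<gamma>) \<longleftrightarrow>
      z \<in> expvecs {1..k} \<and> w \<in> expvecs {1..k} \<and> exponent_map \<alpha> z = exponent_map \<alpha> w" for z w
    using assms exponent_map_in_submonoid_span by (auto simp: factorizations_eq)
  then show ?thesis
    unfolding length_diff_ideal_def binomial_ideal_def
    by (intro arg_cong[of _ _ "genideal (mpoly_ring {1..k})"] Collect_cong) metis
qed

lemma basis_ideal_eq:
  "basis_ideal k G j =
    binomial_ideal {1..k} (\<lambda>z w. \<exists>i\<le>j. monom (Poly_Mapping.single 0 i + z) - monom w \<in> G)"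
  unfolding basis_ideal_def binomial_ideal_def var_power monom_mult
  by (intro arg_cong[of _ _ "genideal (mpoly_ring {1..k})"]) blast

abbreviation drop_var :: "nat \<Rightarrow> expvec \<Rightarrow> expvec" where
  "drop_var x \<equiv> Poly_Mapping.update x 0"

lemma drop_var_add: "drop_var x (m + n) = drop_var x m + drop_var x n"
  by (rule poly_mapping_eqI) (simp add: lookup_add lookup_update)

lemma drop_var_single_add:
  "Poly_Mapping.lookup m x = 0 \<Longrightarrow> drop_var x (Poly_Mapping.single x i + m) = m"
  by (rule poly_mapping_eqI) (auto simp: lookup_add lookup_update lookup_single)

lemma drop_var_id: "Poly_Mapping.lookup m x = 0 \<Longrightarrow> drop_var x m = m"
  using drop_var_single_add[of m x 0] by simp

lemma single_add_drop_var: "Poly_Mapping.single x (Poly_Mapping.lookup m x) + drop_var x m = m"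
  by (rule poly_mapping_eqI) (simp add: lookup_add lookup_update lookup_single when_def)

lemma drop_var_0_in_expvecs: "m \<in> expvecs {0..k} \<Longrightarrow> drop_var 0 m \<in> expvecs {1..k}"
  by (fastforce simp: expvecs_def keys_update)

locale homog_groebner =
  fixes d k :: nat and \<alpha> :: "nat \<Rightarrow> expvec" and r :: "nat rel" and G :: "'a::field mpol set"
  assumes generators: "\<alpha> ` {1..k} \<subseteq> expvecs {1..d}"
    and linear_r: "linear_order_on {0..k} r"
    and t_greatest: "\<And>i. i \<in> {1..k} \<Longrightarrow> (i, 0) \<in> r"
    and reduced_basis:
      "reduced_groebner_basis {0..k} (lex_less {0..k} r) (homog_toric_ideal d k \<alpha>) G"
begin

sublocale lex_order "{0..k}" r
  by unfold_locales (simp_all add: linear_r)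

sublocale toric_groebner "{0..k}" "lex_less {0..k} r" "homog_exp \<alpha>" G
  by unfold_locales (use reduced_basis in \<open>simp_all add: homog_exp_add homog_toric_ideal_eq\<close>)

lemma basis_binomial_length_diff:
  assumes "monom (Poly_Mapping.single 0 i + z) - monom w \<in> G"
    and "z \<in> expvecs {1..k}" "w \<in> expvecs {1..k}"
  shows "i + total_degree z = total_degree w \<and> exponent_map \<alpha> z = exponent_map \<alpha> w"
proof -
  have "Poly_Mapping.single 0 i + z \<in> expvecs {0..k}" "w \<in> expvecs {0..k}"
    using assms by (simp_all add: single_0_add_in_expvecs in_expvecs_atLeast0)
  then have "homog_exp \<alpha> (Poly_Mapping.single 0 i + z) = homog_exp \<alpha> w"
    using assms(1) G_subset_toric_ideal monom_diff_in_toric_ideal_iff by blast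
  then show ?thesis
    using homog_exp_single_add_eq_iff[OF generators] assms by blast
qed

lemma rewrite_rule_tail_t_free:
  assumes "rewrite_rule u v"
  shows "Poly_Mapping.lookup v 0 = 0"
proof (rule ccontr)
  let ?t = "Poly_Mapping.single 0 1 :: expvec"
  assume v: "Poly_Mapping.lookup v 0 \<noteq> 0"
  have "Poly_Mapping.lookup v 0 \<le> Poly_Mapping.lookup u 0"
  proof (rule lex_less_imp_lookup_greatest_le)
    show "lex_less {0..k} r v u"
      using assms by (simp add: rewrite_rule_def)
    show "(i, 0) \<in> r" if "i \<in> {0..k}" for i
      using that t_greatest[of i] r_linear[of 0 0] by (cases "i = 0") auto
  qed simp
  with v have "u = (u - ?t) + ?t" "v = (v - ?t) + ?t"
    by (auto intro!: poly_mapping_eqI simp: lookup_add lookup_minus lookup_single when_def)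
  then have "?t = 0"
    using assms rewrite_rule_coprime by metis
  then show False
    by (metis keys_single keys_zero insert_not_empty zero_neq_one)
qed

lemma rewrite_rule_monom_cong:
  assumes rule: "rewrite_rule u v" and "Poly_Mapping.lookup u 0 \<le> j"
  shows "monom_cong (basis_ideal k G j) (drop_var 0 u) v"
  unfolding basis_ideal_eq
proof (rule monom_cong_binomial_ideal)
  show "drop_var 0 u \<in> expvecs {1..k}" "v \<in> expvecs {1..k}"
    using rewrite_rule_sound(1,2)[OF rule, THEN drop_var_0_in_expvecs]
      drop_var_id[OF rewrite_rule_tail_t_free[OF rule]] by simp_all
  show "\<exists>i\<le>j. monom (Poly_Mapping.single 0 i + drop_var 0 u) - monom v \<in> G"
    using assms single_add_drop_var[of 0 u] by (auto simp: rewrite_rule_def)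
qed

lemma ideal_basis_ideal: "ideal (basis_ideal k G j) (mpoly_ring {1..k})"
  unfolding basis_ideal_eq by (rule ideal_binomial_ideal)

lemma reduces_monom_cong:
  assumes "reduces m n" "m \<in> expvecs {0..k}" "Poly_Mapping.lookup m 0 \<le> j"
  shows "Poly_Mapping.lookup n 0 \<le> j" "monom_cong (basis_ideal k G j) (drop_var 0 m) (drop_var 0 n)"
proof -
  obtain u v q where rule: "rewrite_rule u v" and m: "m = u + q" and n: "n = v + q"
    using assms(1) by (auto simp: reduces.simps)
  have v: "Poly_Mapping.lookup v 0 = 0"
    by (rule rewrite_rule_tail_t_free[OF rule])
  then show "Poly_Mapping.lookup n 0 \<le> j"
    using assms(3) by (simp add: m n lookup_add)
  have "monom_cong (basis_ideal k G j) (drop_var 0 u) v"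
    using rewrite_rule_monom_cong[OF rule] assms(3) by (simp add: m lookup_add)
  moreover have "drop_var 0 q \<in> expvecs {1..k}"
    using assms(2) drop_var_0_in_expvecs by (simp add: m expvecs_add_iff)
  ultimately show "monom_cong (basis_ideal k G j) (drop_var 0 m) (drop_var 0 n)"
    using monom_cong_add_right[OF ideal_basis_ideal] by (simp add: m n drop_var_add drop_var_id[OF v])
qed

lemma rtranclp_reduces_monom_cong:
  assumes "reduces\<^sup>*\<^sup>* m n" "m \<in> expvecs {0..k}" "Poly_Mapping.lookup m 0 \<le> j"
  shows "Poly_Mapping.lookup n 0 \<le> j \<and> monom_cong (basis_ideal k G j) (drop_var 0 m) (drop_var 0 n)"
  using assms(1)
proof (induction rule: rtranclp_induct)
  case base
  then show ?case
    using assms(3) monom_cong_refl[OF ideal_basis_ideal] by blast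
next
  case (step n l)
  then show ?case
    using reduces_monom_cong[OF step.hyps(2)] rtranclp_reduces_fibre[OF step.hyps(1) assms(2)]
      monom_cong_trans[OF ideal_basis_ideal] by blast
qed

lemma same_fibre_monom_cong:
  assumes "m \<in> expvecs {0..k}" "n \<in> expvecs {0..k}" "homog_exp \<alpha> m = homog_exp \<alpha> n"
    and "Poly_Mapping.lookup m 0 \<le> j" "Poly_Mapping.lookup n 0 \<le> j"
  shows "monom_cong (basis_ideal k G j) (drop_var 0 m) (drop_var 0 n)"
proof -
  obtain l where "reduces\<^sup>*\<^sup>* m l" "reduces\<^sup>*\<^sup>* n l"
    using fibre_joinable[OF assms(1-3) finite_homog_exp_fibre[OF generators assms(2)]] .
  then have "monom_cong (basis_ideal k G j) (drop_var 0 m) (drop_var 0 l)"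
    "monom_cong (basis_ideal k G j) (drop_var 0 n) (drop_var 0 l)"
    using rtranclp_reduces_monom_cong assms by simp_all
  then show ?thesis
    using monom_cong_sym[OF ideal_basis_ideal] monom_cong_trans[OF ideal_basis_ideal] by metis
qed

lemma factorizations_monom_cong:
  assumes "z \<in> expvecs {1..k}" "w \<in> expvecs {1..k}" "exponent_map \<alpha> z = exponent_map \<alpha> w"
    and "\<bar>int (total_degree w) - int (total_degree z)\<bar> \<le> int j"
  shows "monom_cong (basis_ideal k G j) z w"
  using assms
proof (induction "total_degree z" "total_degree w" arbitrary: z w rule: linorder_wlog)
  case le
  define i where "i = total_degree w - total_degree z"
  have "i \<le> j"
    using le by (simp add: i_def)
  have z0: "Poly_Mapping.lookup z 0 = 0" and w0: "Poly_Mapping.lookup w 0 = 0"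
    using le.prems(1,2) by (simp_all add: lookup_eq_0_if_expvecs)
  have "Poly_Mapping.single 0 i + z \<in> expvecs {0..k}" "w \<in> expvecs {0..k}"
    using le.prems by (simp_all add: single_0_add_in_expvecs in_expvecs_atLeast0)
  moreover have "homog_exp \<alpha> (Poly_Mapping.single 0 i + z) = homog_exp \<alpha> w"
    using homog_exp_single_add_eq_iff[OF generators] le by (simp add: i_def)
  ultimately have
    "monom_cong (basis_ideal k G j) (drop_var 0 (Poly_Mapping.single 0 i + z)) (drop_var 0 w)"
    using \<open>i \<le> j\<close> z0 w0 by (intro same_fibre_monom_cong) (simp_all add: lookup_add)
  then show ?case
    by (simp add: drop_var_single_add[OF z0] drop_var_id[OF w0])
next
  case sym
  then show ?case
    using monom_cong_sym[OF ideal_basis_ideal] by (simp add: abs_minus_commute)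
qed

end

theorem theorem3p10:
  fixes d k :: nat
    and \<Gamma> :: "expvec set"
    and \<alpha> :: "nat \<Rightarrow> expvec"
    and r :: "nat rel"
    and G :: "'a::field mpol set"
  assumes "affine_semigroup d \<Gamma>"
    and "minimal_generators k \<alpha> \<Gamma>"
    and "linear_order_on {0..k} r"
    and "\<forall>i\<in>{1..k}. (i, 0) \<in> r"
    and "reduced_groebner_basis {0..k} (lex_less {0..k} r) (homog_toric_ideal d k \<alpha>) G"
  shows "\<forall>j::nat. length_diff_ideal k \<alpha> \<Gamma> j = basis_ideal k G j"
proof (intro allI subset_antisym)
  fix j
  have span: "submonoid_span (\<alpha> ` {1..k}) = \<Gamma>"
    using assms(2) by (simp add: minimal_generators_def)
  have "\<alpha> ` {1..k} \<subseteq> expvecs {1..d}"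
    using assms(1) submonoid_span.gen[of _ "\<alpha> ` {1..k}"] span by (auto simp: affine_semigroup_def)
  then interpret homog_groebner d k \<alpha> r G
    by unfold_locales (use assms(3-5) in auto)
  show "length_diff_ideal k \<alpha> \<Gamma> j \<subseteq> basis_ideal k G j"
    unfolding length_diff_ideal_eq[OF span]
    by (rule binomial_ideal_subsetI[OF ideal_basis_ideal]) (blast intro: factorizations_monom_cong)
  show "basis_ideal k G j \<subseteq> length_diff_ideal k \<alpha> \<Gamma> j"
    unfolding length_diff_ideal_eq[OF span] basis_ideal_eq
    by (rule binomial_ideal_subsetI[OF ideal_binomial_ideal], rule monom_cong_binomial_ideal)
      (use basis_binomial_length_diff in fastforce)+
qed

end
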